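(* Let $N\in\mathbb{N}$ and let $\{\mathrm{a}_j:j\in\mathbb{N}\}$ be a sequence of real masks $\mathrm{a}_j=\{\mathrm{a}_{j,k}:k\in\mathbb{Z}\}$ supported in $\{0,\ldots,N\}$ whose normalized trigonometric symbols $a_j(y)=\frac12\sum_{k=0}^N\mathrm{a}_{j,k}e^{-2\pi i k y}$ satisfy $a_j(0)=1$ and $\sup_{y\in\mathbb{R}}|a_j(y)|\le C<\infty$ for all $j\in\mathbb{N}$, with $C$ independent of $j$. Assume that the associated level dependent subdivision scheme converges and that the integer shifts of its basic limit function $\phi=\lim_{j\to\infty}S_{\mathrm{a}_j}\cdots S_{\mathrm{a}_1}\delta$ are linearly independent. Then every analytic limit of the level dependent subdivision scheme is an exponential polynomial.
   Context: The level dependent subdivision scheme associated with the masks is the iteration $c_{j+1}=S_{\mathrm{a}_j}c_j$, $j\in\mathbb{N}$, started from a sequence $c_1\in\ell(\mathbb{Z})$ (the space of all complex sequences on $\mathbb{Z}$), where $(S_{\mathrm{a}_j}c_j)_k=\sum_{m\in\mathbb{Z}}\mathrm{a}_{j,k-2m}\,c_{j,m}$, $k\in\mathbb{Z}$. It converges if for every $c_1\in\ell(\mathbb{Z})$ there is a continuous function $f$ on $\mathbb{R}$ (the limit of the scheme for the starting sequence $c_1$) such that for every compact $K\subset\mathbb{R}$, $\sup\{|c_{j,k}-f(2^{-(j-1)}k)|: k\in\mathbb{Z},\,2^{-(j-1)}k\in K\}\to0$ as $j\to\infty$. The basic limit function $\phi$ is the limit for $c_1=\delta$, where $\delta_0=1$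 and $\delta_k=0$ for $k\ne0$. The limits of the scheme are the functions $\sum_{\ell\in\mathbb{Z}}c_{1,\ell}\,\phi(\cdot-\ell)$, $c_1\in\ell(\mathbb{Z})$, and $\widehat\phi(y)=\int_{\mathbb{R}}\phi(x)e^{-2\pi i xy}dx=\prod_{j=1}^\infty a_j(2^{-j}y)$. The integer shifts of $\phi$ are linearly independent if $\sum_{\ell\in\mathbb{Z}}c_\ell\,\phi(\cdot-\ell)=0$ with $(c_\ell)\in\ell(\mathbb{Z})$ implies $c_\ell=0$ for all $\ell$. An analytic function on $\mathbb{R}$ is an infinitely differentiable function having a power series expansion around each point of $\mathbb{R}$. An exponential polynomial is a finite sum $\sum_j p_j(t)e^{\lambda_j t}$ with $\lambda_j\in\mathbb{C}$ and polynomials $p_j$ with complex coefficients. *)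

theory Defs
  imports "HOL-Analysis.Analysis" "HOL-Computational_Algebra.Polynomial"
begin

definition norm_symbol :: "nat \<Rightarrow> (int \<Rightarrow> real) \<Rightarrow> real \<Rightarrow> complex" where
  "norm_symbol N a y =
     1/2 * (\<Sum>k=0..int N. complex_of_real (a k) * exp (- 2 * of_real pi * \<i> * of_int k * of_real y))"

definition subdiv_op :: "(int \<Rightarrow> real) \<Rightarrow> (int \<Rightarrow> complex) \<Rightarrow> (int \<Rightarrow> complex)" where
  "subdiv_op a c k = (\<Sum>\<^sub>\<infinity>m. complex_of_real (a (k - 2 * m)) * c m)"

text \<open>Levels are numbered from 1: \<open>subdiv_seq a c j\<close> is the sequence \<open>c\<^sub>j\<close> with \<open>c\<^sub>1 = c\<close> and
  \<open>c\<^sub>j\<^sub>+\<^sub>1 = S\<^bsub>a\<^sub>j\<^esub> c\<^sub>j\<close> for \<open>j \<ge> 1\<close>. The value at level 0 is a dummy, and the mask \<open>a 0\<close> is never used.\<close>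

fun subdiv_seq :: "(nat \<Rightarrow> int \<Rightarrow> real) \<Rightarrow> (int \<Rightarrow> complex) \<Rightarrow> nat \<Rightarrow> (int \<Rightarrow> complex)" where
  "subdiv_seq a c 0 = c"
| "subdiv_seq a c (Suc 0) = c"
| "subdiv_seq a c (Suc (Suc j)) = subdiv_op (a (Suc j)) (subdiv_seq a c (Suc j))"

text \<open>The supremum is taken in \<open>[0, \<infinity>]\<close>, so that it is 0 when no grid point lies in \<open>K\<close>.\<close>

definition is_subdiv_limit ::
  "(nat \<Rightarrow> int \<Rightarrow> real) \<Rightarrow> (int \<Rightarrow> complex) \<Rightarrow> (real \<Rightarrow> complex) \<Rightarrow> bool" where
  "is_subdiv_limit a c f \<longleftrightarrow>
     continuous_on UNIV f \<and>
     (\<forall>K::real set. compact K \<longrightarrow>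
        (\<lambda>j. SUP k \<in> {k. real_of_int k / 2 ^ (j - 1) \<in> K}.
               ennreal (cmod (subdiv_seq a c j k - f (real_of_int k / 2 ^ (j - 1)))))
        \<longlonglongrightarrow> 0)"

definition subdiv_converges :: "(nat \<Rightarrow> int \<Rightarrow> real) \<Rightarrow> bool" where
  "subdiv_converges a \<longleftrightarrow> (\<forall>c. \<exists>f. is_subdiv_limit a c f)"

definition delta_seq :: "int \<Rightarrow> complex" where
  "delta_seq k = (if k = 0 then 1 else 0)"

text \<open>No restriction is put on the coefficient sequence. For a compactly supported \<open>\<phi>\<close> (such as a
  basic limit function) every sum below has only finitely many nonzero terms.\<close>

definition lin_indep_shifts :: "(real \<Rightarrow> complex) \<Rightarrow> bool" where
  "lin_indep_shifts \<phi> \<longleftrightarrow>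
     (\<forall>c :: int \<Rightarrow> complex.
        (\<forall>x. ((\<lambda>l. c l * \<phi> (x - of_int l)) has_sum 0) UNIV) \<longrightarrow> (\<forall>l. c l = 0))"

definition infinitely_differentiable :: "(real \<Rightarrow> complex) \<Rightarrow> bool" where
  "infinitely_differentiable f \<longleftrightarrow>
     (\<exists>D :: nat \<Rightarrow> real \<Rightarrow> complex. D 0 = f \<and>
        (\<forall>n x. (D n has_vector_derivative D (Suc n) x) (at x)))"

definition real_analytic :: "(real \<Rightarrow> complex) \<Rightarrow> bool" where
  "real_analytic f \<longleftrightarrow>
     infinitely_differentiable f \<and>
     (\<forall>x0. \<exists>r>0. \<exists>b :: nat \<Rightarrow> complex. \<forall>x. \<bar>x - x0\<bar> < r \<longrightarrow>
        (\<lambda>n. b n * of_real (x - x0) ^ n) sums f x)"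

definition exponential_polynomial :: "(real \<Rightarrow> complex) \<Rightarrow> bool" where
  "exponential_polynomial f \<longleftrightarrow>
     (\<exists>(n::nat) (p :: nat \<Rightarrow> complex poly) (\<mu> :: nat \<Rightarrow> complex).
        \<forall>t. f t = (\<Sum>j<n. poly (p j) (of_real t) * exp (\<mu> j * of_real t)))"

end

theory Submission
  imports Defs "HOL-Complex_Analysis.Cauchy_Integral_Formula"
    "HOL-Computational_Algebra.Fundamental_Theorem_Algebra"
begin

text \<open>
  Subdivision is local. A sequence on the grid of step \<open>2\<^sup>-\<^sup>n\<close> has \<open>N + 1\<close> values on the window
  \<open>{- N..0}\<close>, and they determine everything that the scheme later produces over \<open>[0, 2\<^sup>-\<^sup>n)\<close>. So the
  \<open>N + 2\<close> forward differences of orders \<open>0, \<dots>, N + 1\<close> of that sequence are linearly dependent on the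
  window. Subdivision turns a difference of step \<open>s\<close> into one of step \<open>2 s\<close>, hence the same relation
  survives on all finer levels, and in the limit it becomes a relation
  \<open>\<Sum>p\<le>N+1. d\<^sub>p \<Delta>\<^sub>h\<^sup>p f = 0\<close> with \<open>h = 2\<^sup>-\<^sup>n\<close>, at first on \<open>(0, h)\<close> only. When \<open>f\<close> is analytic the
  relation extends to all of \<open>\<real>\<close> (\<open>analytic_limit_difference_relation\<close>).

  The order \<open>N + 1\<close> does not depend on \<open>n\<close>. Rescaling the coefficients to \<open>d\<^sub>p h\<^sup>p\<close> turns differences into
  difference quotients, and normalizing them gives coefficient vectors on a compact set. A
  convergent subsequence as \<open>h \<rightarrow> 0\<close> yields a nontrivial linear differential equation with constant
  coefficients for \<open>f\<close> (\<open>difference_relations_imp_ODE\<close>), and the solutions of such equations are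
  exponential polynomials (\<open>constant_coefficient_ODE_exponential_polynomial\<close>).
\<close>

section \<open>Linear dependence and compactness\<close>

text \<open>Gaussian elimination: one column with a nonzero entry in row \<open>i\<close> clears this row in all other
  columns, and the induction removes both the row and the column.\<close>

lemma linear_dependence:
  fixes v :: "'j \<Rightarrow> 'i \<Rightarrow> 'a::field"
  assumes "finite I" "finite J" "card I < card J"
  shows "\<exists>d. (\<exists>m\<in>J. d m \<noteq> 0) \<and> (\<forall>i\<in>I. (\<Sum>m\<in>J. d m * v m i) = 0)"
  using assms
proof (induction I arbitrary: J v rule: finite_induct)
  case empty
  then have "J \<noteq> {}" by auto
  then show ?case by (intro exI[of _ "\<lambda>_. 1"]) auto
next
  case (insert i I)
  show ?case
  proof (cases "\<forall>m\<in>J. v m i = 0")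
    case True
    obtain d where "\<exists>m\<in>J. d m \<noteq> 0" "\<forall>i\<in>I. (\<Sum>m\<in>J. d m * v m i) = 0"
      using insert.IH[of J v] insert.prems insert.hyps by auto
    then show ?thesis using True by (intro exI[of _ d]) auto
  next
    case False
    then obtain p where p: "p \<in> J" "v p i \<noteq> 0" by auto
    define K where "K = J - {p}"
    have K: "finite K" "card I < card K" "p \<notin> K" "J = insert p K"
      using insert.prems insert.hyps p by (auto simp: K_def)
    define w where "w m l = v m l - v m i / v p i * v p l" for m l
    obtain d where d: "\<exists>m\<in>K. d m \<noteq> 0" "\<forall>l\<in>I. (\<Sum>m\<in>K. d m * w m l) = 0"
      using insert.IH[of K w] K by auto
    \<comment> \<open>The coefficient of the pivot column collects the multiples of it that were subtracted.\<close>
    define q where "q = - (\<Sum>m\<in>K. d m * v m i / v p i)"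
    define d' where "d' = d(p := q)"
    have key: "(\<Sum>m\<in>J. d' m * v m l) = (\<Sum>m\<in>K. d m * w m l)" for l
    proof -
      have "(\<Sum>m\<in>J. d' m * v m l) = q * v p l + (\<Sum>m\<in>K. d' m * v m l)"
        using K by (simp add: d'_def)
      also have "(\<Sum>m\<in>K. d' m * v m l) = (\<Sum>m\<in>K. d m * v m l)"
        using K(3) by (intro sum.cong) (auto simp: d'_def)
      finally show ?thesis
        by (simp add: q_def w_def sum_distrib_right sum_subtractf right_diff_distrib mult.assoc)
    qed
    have "w m i = 0" for m using p by (simp add: w_def)
    then have "\<forall>l\<in>insert i I. (\<Sum>m\<in>J. d' m * v m l) = 0"
      using d(2) by (simp add: key)
    moreover have "\<exists>m\<in>J. d' m \<noteq> 0" using d(1) K by (auto simp: d'_def)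
    ultimately show ?thesis by blast
  qed
qed

text \<open>The Bolzano-Weierstrass theorem in a finite power, in the form needed for coefficient vectors
  that are indexed by an arbitrary finite set.\<close>

lemma finite_family_convergent_subsequence:
  fixes e :: "nat \<Rightarrow> 'i \<Rightarrow> 'a::heine_borel"
  assumes "finite I" "\<And>k. k \<in> I \<Longrightarrow> bounded (range (\<lambda>j. e j k))"
  shows "\<exists>r l. strict_mono r \<and> (\<forall>k\<in>I. (\<lambda>j. e (r j) k) \<longlonglongrightarrow> l k)"
  using assms
proof (induction I rule: finite_induct)
  case empty
  show ?case by (intro exI[of _ id]) (auto simp: strict_mono_def)
next
  case (insert i I)
  obtain r l where r: "strict_mono r" "\<forall>k\<in>I. (\<lambda>j. e (r j) k) \<longlonglongrightarrow> l k"
    using insert by auto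
  have "bounded (range (\<lambda>j. e (r j) i))"
    using insert.prems[of i] by (auto intro: bounded_subset)
  then obtain x s where s: "strict_mono s" "((\<lambda>j. e (r j) i) \<circ> s) \<longlonglongrightarrow> x"
    using bounded_imp_convergent_subsequence by blast
  have "\<forall>k\<in>insert i I. (\<lambda>j. e ((r \<circ> s) j) k) \<longlonglongrightarrow> (l(i := x)) k"
    using s r(2) insert.hyps LIMSEQ_subseq_LIMSEQ[OF _ s(1)] by (auto simp: o_def)
  then show ?case using strict_mono_o[OF r(1) s(1)] by blast
qed

section \<open>Finite differences\<close>

text \<open>The argument type is left open because the same operator acts on sequences over the integers,
  where the relations arise, and on functions of a real variable, where they are differentiated.\<close>

definition fdiff :: "'a::plus \<Rightarrow> ('a \<Rightarrow> complex) \<Rightarrow> 'a \<Rightarrow> complex" where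
  "fdiff s g x = g (x + s) - g x"

lemma funpow_fdiff_Suc:
  "(fdiff s ^^ Suc m) g x = (fdiff s ^^ m) g (x + s) - (fdiff s ^^ m) g x"
  by (simp add: fdiff_def)

text \<open>A quantitative substitute for the mean value theorem \<open>\<Delta>\<^sub>h\<^sup>k f x = h\<^sup>k f\<^sup>(\<^sup>k\<^sup>) \<xi>\<close>, which fails for complex
  values. In the induction step the functions \<open>\<Delta>\<^sub>h D\<^sub>n\<close> again form a chain of derivatives, and the mean
  value inequality for \<open>D\<^sub>k - c\<cdot>id\<close> shows that the \<open>k\<close>th of them stays within \<open>\<epsilon> h\<close> of the constant
  \<open>h c\<close>.\<close>

lemma funpow_fdiff_sub_line:
  fixes D :: "nat \<Rightarrow> real \<Rightarrow> complex"
  assumes "\<And>n x. (D n has_vector_derivative D (Suc n) x) (at x)" and "h \<ge> 0"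
    and "\<And>y. y \<in> {x..x + real k * h} \<Longrightarrow> cmod (D k y - c) \<le> \<epsilon>"
  shows "cmod ((fdiff h ^^ k) (D 0) x - of_real h ^ k * c) \<le> \<epsilon> * h ^ k"
  using assms
proof (induction k arbitrary: D c \<epsilon>)
  case 0
  then show ?case by simp
next
  case (Suc k)
  have bd: "cmod (fdiff h (D k) y - of_real h * c) \<le> \<epsilon> * h" if y: "y \<in> {x..x + real k * h}" for y
  proof -
    define F where "F t = D k t - of_real t * c" for t
    have "norm (F (y + h) - F y) \<le> \<epsilon> * norm ((y + h) - y)"
    proof (rule differentiable_bound[where S = "{y..y + h}"
          and f' = "\<lambda>t s. s *\<^sub>R (D (Suc k) t - c)"])
      fix t assume t: "t \<in> {y..y + h}"
      have "(F has_vector_derivative (D (Suc k) t - c)) (at t)"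
        unfolding F_def
        by (auto intro!: derivative_eq_intros Suc.prems(1) has_vector_derivative_of_real)
      then show "(F has_derivative (\<lambda>s. s *\<^sub>R (D (Suc k) t - c))) (at t within {y..y + h})"
        by (simp add: has_vector_derivative_def has_derivative_at_withinI)
      have "t \<in> {x..x + real (Suc k) * h}"
        using t y Suc.prems(2) by (auto simp: algebra_simps)
      then have "cmod (D (Suc k) t - c) \<le> \<epsilon>" using Suc.prems(3) by blast
      then show "onorm (\<lambda>s. s *\<^sub>R (D (Suc k) t - c)) \<le> \<epsilon>"
        using mult_left_mono[OF _ abs_ge_zero] by (intro onorm_le) (fastforce simp: mult.commute)
    qed (use Suc.prems(2) in auto)
    then show ?thesis using Suc.prems(2) by (simp add: F_def fdiff_def algebra_simps)
  qed
  have chain: "(fdiff h (D n) has_vector_derivative fdiff h (D (Suc n)) t) (at t)" for n t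
  proof -
    have "((\<lambda>t. D n (t + h)) has_vector_derivative D (Suc n) (t + h)) (at t)"
      using vector_diff_chain_at[of "\<lambda>t. t + h" 1 t "D n", OF _ Suc.prems(1)]
        has_vector_derivative_add_const[of "\<lambda>t. t" h 1 "at t"]
      by (simp add: o_def)
    then show ?thesis
      unfolding fdiff_def[abs_def]
      by (intro has_vector_derivative_diff Suc.prems(1))
  qed
  have "cmod ((fdiff h ^^ k) (fdiff h (D 0)) x - of_real h ^ k * (of_real h * c)) \<le> \<epsilon> * h * h ^ k"
    by (rule Suc.IH[where D = "\<lambda>n. fdiff h (D n)"]) (use chain bd Suc.prems(2) in auto)
  then show ?case by (simp add: funpow_Suc_right mult_ac del: funpow.simps)
qed

lemma divided_difference_tendsto_derivative:
  fixes D :: "nat \<Rightarrow> real \<Rightarrow> complex"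
  assumes chain: "\<And>n x. (D n has_vector_derivative D (Suc n) x) (at x)"
  shows "((\<lambda>h. (fdiff h ^^ k) (D 0) x / of_real h ^ k) \<longlongrightarrow> D k x) (at_right 0)"
proof (rule tendstoI)
  fix \<epsilon> :: real assume \<epsilon>: "\<epsilon> > 0"
  have "isCont (D k) x" using chain has_vector_derivative_continuous by blast
  then obtain \<delta> where \<delta>: "\<delta> > 0" "\<And>y. \<bar>y - x\<bar> < \<delta> \<Longrightarrow> cmod (D k y - D k x) < \<epsilon> / 2"
    using \<epsilon> half_gt_zero[OF \<epsilon>] unfolding continuous_at_eps_delta dist_norm real_norm_def by blast
  have "eventually (\<lambda>h. h < \<delta> / (real k + 1)) (at_right (0::real))"
    using \<delta>(1) by (intro eventually_at_right_real order_tendstoD(2)[OF tendsto_ident_at]) auto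
  moreover have "eventually (\<lambda>h. h > 0) (at_right (0::real))"
    by (simp add: eventually_at_right_less)
  ultimately show "eventually (\<lambda>h. dist ((fdiff h ^^ k) (D 0) x / of_real h ^ k) (D k x) < \<epsilon>) (at_right 0)"
  proof eventually_elim
    case (elim h)
    then have "real k * h < \<delta>" by (simp add: field_simps)
    then have "cmod ((fdiff h ^^ k) (D 0) x - of_real h ^ k * D k x) \<le> \<epsilon> / 2 * h ^ k"
      using elim \<delta>(2) by (intro funpow_fdiff_sub_line chain) (force intro: less_imp_le)+
    then have "cmod ((fdiff h ^^ k) (D 0) x - of_real h ^ k * D k x) / h ^ k \<le> \<epsilon> / 2"
      using elim by (simp add: field_simps)
    also have "cmod ((fdiff h ^^ k) (D 0) x - of_real h ^ k * D k x) / h ^ k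
        = cmod (((fdiff h ^^ k) (D 0) x - of_real h ^ k * D k x) / of_real h ^ k)"
      using elim by (simp add: norm_divide norm_power)
    also have "((fdiff h ^^ k) (D 0) x - of_real h ^ k * D k x) / of_real h ^ k
        = (fdiff h ^^ k) (D 0) x / of_real h ^ k - D k x"
      using elim by (simp add: field_simps)
    finally show ?case using \<epsilon> by (simp add: dist_norm)
  qed
qed

text \<open>The relation for the step \<open>h\<close> is one between the quotients \<open>\<Delta>\<^sub>h\<^sup>k f / h\<^sup>k\<close> with coefficients \<open>d\<^sub>k h\<^sup>k\<close>.
  After division by the sum \<open>s\<close> of their moduli they have \<open>\<ell>\<^sup>1\<close> norm 1, so that a limit of them
  along a subsequence exists and is not zero.\<close>

lemma difference_relations_imp_ODE:
  fixes D :: "nat \<Rightarrow> real \<Rightarrow> complex"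
  assumes chain: "\<And>n x. (D n has_vector_derivative D (Suc n) x) (at x)"
    and h: "\<And>n. h n > 0" "h \<longlonglongrightarrow> 0"
    and rel: "\<And>n. \<exists>d. (\<exists>k\<le>M. d k \<noteq> 0) \<and> (\<forall>x. (\<Sum>k\<le>M. d k * (fdiff (h n) ^^ k) (D 0) x) = 0)"
  shows "\<exists>e. (\<exists>k\<le>M. e k \<noteq> 0) \<and> (\<forall>x. (\<Sum>k\<le>M. e k * D k x) = 0)"
proof -
  obtain d where d: "\<And>n. \<exists>k\<le>M. d n k \<noteq> 0"
    "\<And>n x. (\<Sum>k\<le>M. d n k * (fdiff (h n) ^^ k) (D 0) x) = 0"
    using rel by metis
  define s where "s n = (\<Sum>k\<le>M. cmod (d n k) * h n ^ k)" for n
  define e where "e n k = d n k * of_real (h n) ^ k / of_real (s n)" for n k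
  have hne: "h n \<noteq> 0" for n using h(1)[of n] by simp
  have s: "s n > 0" for n
    using d(1)[of n] h(1)[of n] unfolding s_def
    by (auto intro!: sum_pos2[where f = "\<lambda>k. cmod (d n k) * h n ^ k"])
  have ecmod: "cmod (e n k) = cmod (d n k) * h n ^ k / s n" for n k
    using s[of n] h(1)[of n] by (simp add: e_def norm_mult norm_divide norm_power)
  have e1: "(\<Sum>k\<le>M. cmod (e n k)) = 1" for n
    using s[of n] by (simp add: ecmod flip: sum_divide_distrib s_def)
  have "cmod (e n k) \<le> 1" if "k \<le> M" for n k
    using member_le_sum[of k "{..M}" "\<lambda>k. cmod (e n k)"] e1[of n] that by simp
  then have "bounded (range (\<lambda>n. e n k))" if "k \<in> {..M}" for k
    using that by (auto simp: bounded_iff)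
  from finite_family_convergent_subsequence[where I = "{..M}" and e = e, OF finite_atMost this]
  obtain r l where r: "strict_mono r" and "\<forall>k\<in>{..M}. (\<lambda>n. e (r n) k) \<longlonglongrightarrow> l k"
    by blast
  then have l: "(\<lambda>n. e (r n) k) \<longlonglongrightarrow> l k" if "k \<le> M" for k using that by auto
  have "(\<lambda>n. \<Sum>k\<le>M. cmod (e (r n) k)) \<longlonglongrightarrow> (\<Sum>k\<le>M. cmod (l k))"
    by (intro tendsto_intros l) auto
  then have "(\<Sum>k\<le>M. cmod (l k)) = 1" by (simp add: e1 LIMSEQ_const_iff)
  then have ne: "\<exists>k\<le>M. l k \<noteq> 0" by (force intro: ccontr)
  have hr: "filterlim (\<lambda>n. h (r n)) (at_right 0) sequentially"
    using LIMSEQ_subseq_LIMSEQ[OF h(2) r] h(1)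
    by (intro filterlim_at_withinI) (auto simp: o_def filterlim_at)
  have "(\<Sum>k\<le>M. l k * D k x) = 0" for x
  proof -
    have "(\<lambda>n. \<Sum>k\<le>M. e (r n) k * ((fdiff (h (r n)) ^^ k) (D 0) x / of_real (h (r n)) ^ k))
        \<longlonglongrightarrow> (\<Sum>k\<le>M. l k * D k x)"
      using filterlim_compose[OF divided_difference_tendsto_derivative[where D = D, OF chain] hr]
      by (intro tendsto_intros l) auto
    moreover have "(\<Sum>k\<le>M. e n k * ((fdiff (h n) ^^ k) (D 0) x / of_real (h n) ^ k)) = 0" for n
    proof -
      have "(\<Sum>k\<le>M. e n k * ((fdiff (h n) ^^ k) (D 0) x / of_real (h n) ^ k))
          = (\<Sum>k\<le>M. d n k * (fdiff (h n) ^^ k) (D 0) x) / of_real (s n)"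
        unfolding sum_divide_distrib using hne[of n] by (intro sum.cong) (auto simp: e_def)
      then show ?thesis by (simp add: d(2))
    qed
    ultimately show ?thesis by (simp add: LIMSEQ_const_iff)
  qed
  with ne show ?thesis by blast
qed


section \<open>Locally convergent power series\<close>

text \<open>The power series clause of analyticity, on its own because it passes to shifts and linear
  combinations without any bookkeeping of derivatives.\<close>

definition locally_power_series :: "(real \<Rightarrow> complex) \<Rightarrow> bool" where
  "locally_power_series f \<longleftrightarrow>
     (\<forall>x0. \<exists>r>0. \<exists>b :: nat \<Rightarrow> complex. \<forall>x. \<bar>x - x0\<bar> < r \<longrightarrow>
        (\<lambda>n. b n * of_real (x - x0) ^ n) sums f x)"

lemma locally_power_series_0: "locally_power_series (\<lambda>x. 0)"
  unfolding locally_power_series_def by (intro allI exI[of _ 1] conjI exI[of _ "\<lambda>_. 0"]) auto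

lemma locally_power_series_shift:
  assumes "locally_power_series f"
  shows "locally_power_series (\<lambda>x. f (x + s))"
  unfolding locally_power_series_def
proof
  fix x0
  obtain r b where "r > 0" and
    b: "\<And>x. \<bar>x - (x0 + s)\<bar> < r \<Longrightarrow> (\<lambda>n. b n * of_real (x - (x0 + s)) ^ n) sums f x"
    using assms unfolding locally_power_series_def by metis
  moreover have "(\<lambda>n. b n * of_real (x - x0) ^ n) sums f (x + s)" if "\<bar>x - x0\<bar> < r" for x
    using b[of "x + s"] that by simp
  ultimately show "\<exists>r>0. \<exists>b. \<forall>x. \<bar>x - x0\<bar> < r \<longrightarrow> (\<lambda>n. b n * of_real (x - x0) ^ n) sums f (x + s)"
    by blast
qed

lemma locally_power_series_lincomb:
  assumes "locally_power_series f" "locally_power_series g"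
  shows "locally_power_series (\<lambda>x. c * f x + d * g x)"
  unfolding locally_power_series_def
proof
  fix x0
  obtain r b where r: "r > 0" and
    b: "\<And>x. \<bar>x - x0\<bar> < r \<Longrightarrow> (\<lambda>n. b n * of_real (x - x0) ^ n) sums f x"
    using assms(1) unfolding locally_power_series_def by metis
  obtain r' b' where r': "r' > 0" and
    b': "\<And>x. \<bar>x - x0\<bar> < r' \<Longrightarrow> (\<lambda>n. b' n * of_real (x - x0) ^ n) sums g x"
    using assms(2) unfolding locally_power_series_def by metis
  have "(\<lambda>n. (c * b n + d * b' n) * of_real (x - x0) ^ n) sums (c * f x + d * g x)"
    if "\<bar>x - x0\<bar> < min r r'" for x
    using sums_add[OF sums_mult[OF b, of x c] sums_mult[OF b', of x d]] that
    by (simp add: algebra_simps)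
  then show "\<exists>r>0. \<exists>b. \<forall>x. \<bar>x - x0\<bar> < r \<longrightarrow> (\<lambda>n. b n * of_real (x - x0) ^ n) sums (c * f x + d * g x)"
    using r r' by (intro exI[of _ "min r r'"] conjI exI[of _ "\<lambda>n. c * b n + d * b' n"]) auto
qed

lemma locally_power_series_fdiff:
  assumes "locally_power_series f"
  shows "locally_power_series ((fdiff s ^^ m) f)"
proof (induction m)
  case (Suc m)
  then have "locally_power_series (\<lambda>x. 1 * (fdiff s ^^ m) f (x + s) + (-1) * (fdiff s ^^ m) f x)"
    by (intro locally_power_series_lincomb locally_power_series_shift)
  then show ?case by (simp add: fdiff_def[abs_def])
qed (use assms in simp)

lemma locally_power_series_sum:
  assumes "finite I" "\<And>k. k \<in> I \<Longrightarrow> locally_power_series (g k)"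
  shows "locally_power_series (\<lambda>x. \<Sum>k\<in>I. d k * g k x)"
  using assms
proof (induction I rule: finite_induct)
  case (insert k I)
  then have "locally_power_series (\<lambda>x. d k * g k x + 1 * (\<Sum>k\<in>I. d k * g k x))"
    by (intro locally_power_series_lincomb) auto
  then show ?case using insert.hyps by simp
qed (simp add: locally_power_series_0)

text \<open>The real series converges on the complex disc of the same radius, so the isolation of zeros of
  complex power series forces all coefficients to vanish.\<close>

lemma power_series_zeros_accumulate:
  assumes r: "r > 0" and "g x0 = 0"
    and sums: "\<And>x. \<bar>x - x0\<bar> < r \<Longrightarrow> (\<lambda>n. b n * of_real (x - x0) ^ n) sums g x"
    and acc: "\<And>s. s > 0 \<Longrightarrow> \<exists>y. y \<noteq> x0 \<and> \<bar>y - x0\<bar> < s \<and> g y = 0"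
    and x: "\<bar>x - x0\<bar> < r"
  shows "g x = (0 :: complex)"
proof -
  define F where "F z = (\<Sum>n. b n * z ^ n)" for z
  have Fsums: "(\<lambda>n. b n * z ^ n) sums F z" if z: "norm z < r" for z
  proof -
    \<comment> \<open>Convergence at a real point of modulus between \<open>norm z\<close> and \<open>r\<close> gives convergence at \<open>z\<close>.\<close>
    define t where "t = (norm z + r) / 2"
    have t: "norm z < t" "t < r" "t > 0"
      using z r by (auto simp: t_def add_nonneg_pos)
    have "summable (\<lambda>n. b n * of_real t ^ n)"
      using sums[of "x0 + t"] t by (auto simp: sums_iff)
    then show ?thesis
      using powser_inside[of b "of_real t" z] t by (auto simp: F_def sums_iff)
  qed
  have Fg: "F (of_real (y - x0)) = g y" if "\<bar>y - x0\<bar> < r" for y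
    using sums[OF that] Fsums[of "of_real (y - x0)"] that by (auto intro: sums_unique2 simp flip: of_real_diff)
  have "b m = 0" if "m > 0" for m
  proof (rule ccontr)
    assume "b m \<noteq> 0"
    moreover have "F 0 = 0" using Fg[of x0] r assms(2) by simp
    moreover have "(\<lambda>n. b n * (z - 0) ^ n) sums F z" if "norm (z - 0) < r" for z
      using Fsums that by simp
    ultimately obtain s where s: "s > 0" "\<And>z. z \<in> cball 0 s - {0} \<Longrightarrow> F z \<noteq> 0"
      using powser_0_nonzero[of r 0 b F m] r \<open>m > 0\<close> by metis
    obtain y where y: "y \<noteq> x0" "\<bar>y - x0\<bar> < min s r" "g y = 0"
      using acc[of "min s r"] s r by auto
    then have "of_real (y - x0) \<in> cball (0::complex) s - {0}" by (auto simp flip: of_real_diff)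
    then show False using s(2) Fg[of y] y by auto
  qed
  moreover have "b 0 = 0" using sums[of x0] r assms(2) powser_sums_zero_iff[of b] by simp
  ultimately have "b = (\<lambda>_. 0)" by (auto simp: fun_eq_iff) (metis gr0I)
  then show ?thesis using sums[OF x] by (simp add: sums_iff)
qed

text \<open>The identity theorem: the interior of the zero set is open by definition, and closed because zeros
  accumulate at each of its boundary points; as \<open>\<real>\<close> is connected, it is everything.\<close>

lemma locally_power_series_eq_0:
  assumes cont: "continuous_on UNIV g" and g: "locally_power_series g"
    and "u < v" and zero: "\<And>x. u < x \<Longrightarrow> x < v \<Longrightarrow> g x = 0"
  shows "g x = 0"
proof -
  define S where "S = {x. eventually (\<lambda>y. g y = 0) (nhds x)}"
  have "open S"
    unfolding S_def eventually_nhds by (subst open_subopen) blast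
  have gS: "g y = 0" if "y \<in> S" for y
    using that by (auto simp: S_def dest: eventually_nhds_x_imp_x)
  have "closed S"
  proof -
    have "x0 \<in> S" if x0: "x0 \<in> closure S" for x0
    proof -
      have "closed {x. g x = 0}" using closed_Collect_eq[OF cont continuous_on_const] .
      then have "closure S \<subseteq> {x. g x = 0}" using gS by (intro closure_minimal) auto
      then have g0: "g x0 = 0" using x0 by auto
      show ?thesis
      proof (rule ccontr)
        assume nS: "x0 \<notin> S"
        have acc: "\<exists>y. y \<noteq> x0 \<and> \<bar>y - x0\<bar> < s \<and> g y = 0" if "s > 0" for s
          using x0 that nS gS unfolding closure_approachable dist_real_def by metis
        obtain r b where "r > 0" and
          b: "\<And>x. \<bar>x - x0\<bar> < r \<Longrightarrow> (\<lambda>n. b n * of_real (x - x0) ^ n) sums g x"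
          using g unfolding locally_power_series_def by metis
        then have "\<forall>y. dist y x0 < r \<longrightarrow> g y = 0"
          using power_series_zeros_accumulate[OF _ g0 b acc] by (simp add: dist_real_def)
        then have "x0 \<in> S" using \<open>r > 0\<close> by (auto simp: S_def eventually_nhds_metric)
        with nS show False ..
      qed
    qed
    then show ?thesis by (metis closure_subset_eq subsetI)
  qed
  have "(u + v) / 2 \<in> S"
    unfolding S_def using \<open>u < v\<close> zero
    by (auto simp: eventually_nhds intro!: exI[of _ "{u<..<v}"])
  then have "S = UNIV"
    using connected_UNIV \<open>open S\<close> \<open>closed S\<close> by (auto simp: connected_clopen)
  then show ?thesis using gS by auto
qed

section \<open>Linear differential equations with constant coefficients\<close>

lemma exponential_polynomial_term:
  "exponential_polynomial (\<lambda>t. poly p (of_real t) * exp (\<mu> * of_real t))"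
  unfolding exponential_polynomial_def
  by (intro exI[of _ 1] exI[of _ "\<lambda>_. p"] exI[of _ "\<lambda>_. \<mu>"]) simp

lemma exponential_polynomial_add:
  assumes "exponential_polynomial f" "exponential_polynomial g"
  shows "exponential_polynomial (\<lambda>t. f t + g t)"
proof -
  obtain n :: nat and p \<mu> where f: "\<forall>t. f t = (\<Sum>j<n. poly (p j) (of_real t) * exp (\<mu> j * of_real t))"
    using assms(1)[unfolded exponential_polynomial_def] by (elim exE) (rule that)
  obtain m :: nat and q \<nu> where g: "\<forall>t. g t = (\<Sum>j<m. poly (q j) (of_real t) * exp (\<nu> j * of_real t))"
    using assms(2)[unfolded exponential_polynomial_def] by (elim exE) (rule that)
  define P where "P j = (if j < n then p j else q (j - n))" for j
  define M where "M j = (if j < n then \<mu> j else \<nu> (j - n))" for j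
  have "(\<Sum>j<n + m'. poly (P j) (of_real t) * exp (M j * of_real t))
      = f t + (\<Sum>j<m'. poly (q j) (of_real t) * exp (\<nu> j * of_real t))" for t m'
    by (induction m') (simp_all add: f P_def M_def add.assoc)
  from this[of _ m]
  have "\<forall>t. f t + g t = (\<Sum>j<n + m. poly (P j) (of_real t) * exp (M j * of_real t))"
    by (simp add: g)
  then show ?thesis
    unfolding exponential_polynomial_def by blast
qed

lemma exponential_polynomial_mult_exp:
  assumes "exponential_polynomial f"
  shows "exponential_polynomial (\<lambda>t. f t * exp (\<alpha> * of_real t))"
proof -
  obtain n :: nat and p \<mu> where f: "\<forall>t. f t = (\<Sum>j<n. poly (p j) (of_real t) * exp (\<mu> j * of_real t))"
    using assms(1)[unfolded exponential_polynomial_def] by (elim exE) (rule that)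
  show ?thesis
    unfolding exponential_polynomial_def
    by (intro exI[of _ n] exI[of _ p] exI[of _ "\<lambda>j. \<mu> j + \<alpha>"])
      (simp add: f sum_distrib_right distrib_right exp_add mult.assoc)
qed

text \<open>The polynomial part of an antiderivative: \<open>(q e\<^sup>\<mu>\<^sup>t)' = p e\<^sup>\<mu>\<^sup>t\<close> means \<open>q' + \<mu> q = p\<close>. For \<open>\<mu> \<noteq> 0\<close>
  the substitution \<open>q = (p - r) / \<mu>\<close> reduces \<open>p\<close> to \<open>p'\<close>, which has smaller degree.\<close>

lemma ex_poly_pderiv_add_smult:
  fixes p :: "'a::field_char_0 poly"
  shows "\<exists>q. pderiv q + smult \<mu> q = p"
proof (cases "\<mu> = 0")
  case True
  define q where "q = (\<Sum>i\<le>degree p. monom (coeff p i / of_nat (Suc i)) (Suc i))"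
  have "pderiv q = (\<Sum>i\<le>degree p. pderiv (monom (coeff p i / of_nat (Suc i)) (Suc i)))"
    unfolding q_def using higher_pderiv_sum[of 1] by simp
  also have "\<dots> = (\<Sum>i\<le>degree p. monom (coeff p i) i)"
    by (intro sum.cong) (simp_all add: pderiv_monom del: of_nat_Suc)
  finally show ?thesis using True by (auto simp: poly_as_sum_of_monoms)
next
  case False
  show ?thesis
  proof (induction "degree p" arbitrary: p rule: less_induct)
    case less
    show ?case
    proof (cases "degree p = 0")
      case True
      then show ?thesis using False
        by (intro exI[of _ "smult (1 / \<mu>) p"]) (simp add: pderiv_smult pderiv_eq_0_iff[THEN iffD2])
    next
      case deg: False
      then obtain q where "pderiv q + smult \<mu> q = pderiv p"
        using less[of "pderiv p"] by (auto simp: degree_pderiv)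
      then have "pderiv q = pderiv p - smult \<mu> q" by (simp add: algebra_simps)
      then have "pderiv (smult (1 / \<mu>) (p - q)) + smult \<mu> (smult (1 / \<mu>) (p - q)) = p"
        using False by (simp add: pderiv_smult pderiv_diff smult_diff_right)
      then show ?thesis by blast
    qed
  qed
qed

lemma exponential_polynomial_antiderivative:
  assumes "exponential_polynomial g"
  shows "\<exists>G. exponential_polynomial G \<and> (\<forall>t. (G has_vector_derivative g t) (at t))"
proof -
  obtain n :: nat and p \<mu> where g: "\<forall>t. g t = (\<Sum>j<n. poly (p j) (of_real t) * exp (\<mu> j * of_real t))"
    using assms(1)[unfolded exponential_polynomial_def] by (elim exE) (rule that)
  have "\<forall>j. \<exists>q. pderiv q + smult (\<mu> j) q = p j"
    by (intro allI ex_poly_pderiv_add_smult)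
  from choice[OF this] obtain q where q: "\<forall>j. pderiv (q j) + smult (\<mu> j) (q j) = p j" ..
  define G where "G t = (\<Sum>j<n. poly (q j) (of_real t) * exp (\<mu> j * of_real t))" for t :: real
  have "(G has_vector_derivative g t) (at t)" for t
    unfolding G_def[abs_def] g[rule_format]
  proof (rule has_vector_derivative_sum)
    fix j
    have "((\<lambda>z. poly (q j) z * exp (\<mu> j * z)) has_field_derivative
        poly (p j) (of_real t) * exp (\<mu> j * of_real t)) (at (of_real t))"
      by (auto intro!: derivative_eq_intros poly_DERIV simp: algebra_simps simp flip: q[rule_format])
    then show "((\<lambda>t. poly (q j) (of_real t) * exp (\<mu> j * of_real t)) has_vector_derivative
        poly (p j) (of_real t) * exp (\<mu> j * of_real t)) (at t)"
      by (rule has_vector_derivative_real_field)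
  qed
  moreover have "exponential_polynomial G"
    unfolding exponential_polynomial_def G_def by blast
  ultimately show ?thesis by blast
qed

text \<open>The integrating factor \<open>e\<^sup>-\<^sup>\<alpha>\<^sup>t\<close> reduces the equation \<open>f' = \<alpha> f + g\<close> to an antiderivative.\<close>

lemma exponential_polynomial_first_order:
  assumes f: "\<And>t. (f has_vector_derivative (\<alpha> * f t + g t)) (at t)"
    and g: "exponential_polynomial g"
  shows "exponential_polynomial f"
proof -
  obtain G where G: "exponential_polynomial G"
    "\<And>t. (G has_vector_derivative g t * exp (- \<alpha> * of_real t)) (at t)"
    using exponential_polynomial_antiderivative[OF exponential_polynomial_mult_exp[OF g, of "- \<alpha>"]]
    by auto
  define u where "u t = f t * exp (- \<alpha> * of_real t) - G t" for t
  have E: "((\<lambda>t. exp (- \<alpha> * of_real t)) has_vector_derivative - \<alpha> * exp (- \<alpha> * of_real t)) (at t)"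
    for t :: real
    by (rule has_vector_derivative_real_field) (auto intro!: derivative_eq_intros)
  have "(u has_vector_derivative 0) (at t)" for t
    unfolding u_def[abs_def]
    using has_vector_derivative_diff[OF has_vector_derivative_mult[OF f[of t] E[of t]] G(2)[of t]]
    by (simp add: algebra_simps)
  then obtain c where c: "\<And>t. u t = c"
    using has_vector_derivative_zero_constant[of UNIV u] by auto
  have "f t = (G t + poly [:c:] (of_real t) * exp (0 * of_real t)) * exp (\<alpha> * of_real t)" for t
  proof -
    have "exp (- \<alpha> * of_real t) * exp (\<alpha> * of_real t) = 1" by (simp flip: exp_add)
    then have "f t = f t * exp (- \<alpha> * of_real t) * exp (\<alpha> * of_real t)" by simp
    also have "f t * exp (- \<alpha> * of_real t) = G t + c" using c[of t] by (simp add: u_def diff_eq_eq add.commute)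
    finally show ?thesis by simp
  qed
  then have "f = (\<lambda>t. (G t + poly [:c:] (of_real t) * exp (0 * of_real t)) * exp (\<alpha> * of_real t))"
    by blast
  then show ?thesis
    using exponential_polynomial_mult_exp[OF exponential_polynomial_add[OF G(1) exponential_polynomial_term]]
    by metis
qed

text \<open>A root \<open>\<alpha>\<close> of \<open>P\<close> splits off a first-order factor: if \<open>P = (X - \<alpha>) Q\<close> then \<open>f' - \<alpha> f\<close> solves the
  equation of \<open>Q\<close>, hence is an exponential polynomial by induction, and so is \<open>f\<close>.\<close>

lemma constant_coefficient_ODE_exponential_polynomial:
  fixes D :: "nat \<Rightarrow> real \<Rightarrow> complex"
  assumes "\<And>n x. (D n has_vector_derivative D (Suc n) x) (at x)"
    and "P \<noteq> 0" and "\<And>x. (\<Sum>k\<le>degree P. coeff P k * D k x) = 0"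
  shows "exponential_polynomial (D 0)"
  using assms
proof (induction "degree P" arbitrary: P D)
  case 0
  then have "coeff P 0 \<noteq> 0" by (metis leading_coeff_0_iff)
  then have "D 0 = (\<lambda>t. poly 0 (of_real t) * exp (0 * of_real t))" using 0 by auto
  then show ?case using exponential_polynomial_term by metis
next
  case (Suc n)
  then obtain \<alpha> where "poly P \<alpha> = 0"
    by (metis fundamental_theorem_of_algebra constant_degree nat.distinct(1))
  then obtain Q where Q: "P = [:-\<alpha>, 1:] * Q" by (metis poly_eq_0_iff_dvd dvdE)
  then have "Q \<noteq> 0" using Suc by auto
  then have deg: "degree Q = n" using Suc.hyps(2) by (simp add: Q degree_mult_eq del: mult_pCons_left)
  define D' where "D' k x = D (Suc k) x - \<alpha> * D k x" for k x
  have "exponential_polynomial (D' 0)"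
  proof (rule Suc.hyps(1)[of Q D'])
    show "n = degree Q" by (simp add: deg)
    show "Q \<noteq> 0" by fact
    show "(D' k has_vector_derivative D' (Suc k) x) (at x)" for k x
      unfolding D'_def[abs_def]
      by (intro has_vector_derivative_diff has_vector_derivative_mult_right Suc.prems(1))
    show "(\<Sum>k\<le>degree Q. coeff Q k * D' k x) = 0" for x
    proof -
      have P: "coeff P k = - \<alpha> * coeff Q k + (case k of 0 \<Rightarrow> 0 | Suc k \<Rightarrow> coeff Q k)" for k
        by (simp add: Q coeff_pCons)
      have "0 = (\<Sum>k\<le>Suc n. coeff P k * D k x)" using Suc.prems(3)[of x] Suc.hyps(2) by simp
      also have "\<dots> = - (\<Sum>k\<le>Suc n. \<alpha> * coeff Q k * D k x)
          + (\<Sum>k\<le>Suc n. (case k of 0 \<Rightarrow> 0 | Suc k \<Rightarrow> coeff Q k) * D k x)"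
        by (simp add: P left_diff_distrib sum_subtractf del: sum.atMost_Suc)
      also have "(\<Sum>k\<le>Suc n. \<alpha> * coeff Q k * D k x) = (\<Sum>k\<le>n. \<alpha> * coeff Q k * D k x)"
        by (simp add: coeff_eq_0 deg)
      also have "(\<Sum>k\<le>Suc n. (case k of 0 \<Rightarrow> 0 | Suc k \<Rightarrow> coeff Q k) * D k x)
          = (\<Sum>k\<le>n. coeff Q k * D (Suc k) x)"
        by (subst sum.atMost_Suc_shift) simp
      also have "- (\<Sum>k\<le>n. \<alpha> * coeff Q k * D k x) + (\<Sum>k\<le>n. coeff Q k * D (Suc k) x)
          = (\<Sum>k\<le>degree Q. coeff Q k * D' k x)"
        by (simp add: D'_def deg algebra_simps sum_subtractf)
      finally show ?thesis by simp
    qed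
  qed
  moreover have "(D 0 has_vector_derivative (\<alpha> * D 0 t + D' 0 t)) (at t)" for t
    using Suc.prems(1)[of 0 t] by (simp add: D'_def)
  ultimately show ?case by (rule exponential_polynomial_first_order[rotated])
qed

section \<open>Differences of subdivision sequences\<close>

lemma subdiv_op_eq_sum:
  assumes "\<And>k. k \<notin> {0..int N} \<Longrightarrow> a k = 0"
  shows "subdiv_op a c k = (\<Sum>m | k - 2 * m \<in> {0..int N}. complex_of_real (a (k - 2 * m)) * c m)"
    and "finite {m. k - 2 * m \<in> {0..int N}}"
proof -
  have "{m. k - 2 * m \<in> {0..int N}} \<subseteq> {-\<bar>k\<bar> - int N..\<bar>k\<bar>}" by auto
  then show fin: "finite {m. k - 2 * m \<in> {0..int N}}" by (rule finite_subset) simp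
  have "subdiv_op a c k
      = (\<Sum>\<^sub>\<infinity>m\<in>{m. k - 2 * m \<in> {0..int N}}. complex_of_real (a (k - 2 * m)) * c m)"
    unfolding subdiv_op_def by (rule infsum_cong_neutral) (use assms in auto)
  then show "subdiv_op a c k = (\<Sum>m | k - 2 * m \<in> {0..int N}. complex_of_real (a (k - 2 * m)) * c m)"
    using fin by simp
qed

lemma funpow_fdiff_subdiv_op:
  assumes supp: "\<And>k. k \<notin> {0..int N} \<Longrightarrow> a k = 0"
  shows "(fdiff (2 * s) ^^ p) (subdiv_op a c) = subdiv_op a ((fdiff s ^^ p) c)"
proof (induction p)
  case (Suc p)
  have eq: "subdiv_op a c k = (\<Sum>m | k - 2 * m \<in> {0..int N}. complex_of_real (a (k - 2 * m)) * c m)" for c k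
    by (rule subdiv_op_eq_sum(1)) (rule supp)
  have "fdiff (2 * s) (subdiv_op a c) k = subdiv_op a (fdiff s c) k" for c k
  proof -
    have "subdiv_op a c (k + 2 * s)
        = (\<Sum>m | k - 2 * m \<in> {0..int N}. complex_of_real (a (k - 2 * m)) * c (m + s))"
      unfolding eq
      by (rule sum.reindex_bij_witness[of _ "\<lambda>m. m + s" "\<lambda>m. m - s"]) (auto simp: algebra_simps)
    then show ?thesis
      by (simp add: fdiff_def eq[of _ k] right_diff_distrib sum_subtractf)
  qed
  then have "fdiff (2 * s) (subdiv_op a c) = subdiv_op a (fdiff s c)" for c by blast
  with Suc show ?case by simp
qed simp

text \<open>The window is \<open>{- N..0}\<close> because an entry of index \<open>l \<in> {- N..2\<^sup>i\<^sup>+\<^sup>1 - 1}\<close> depends only on the coarser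
  entries with \<open>l - N \<le> 2 m \<le> l\<close>, and these \<open>m\<close> lie in \<open>{- N..2\<^sup>i - 1}\<close>. The left end stays fixed while
  the right end doubles, as the grid does, so the relation holds over a fixed real interval.\<close>

lemma difference_relation_propagates:
  assumes supp: "\<And>j k. j \<ge> 1 \<Longrightarrow> k \<notin> {0..int N} \<Longrightarrow> a j k = 0"
    and base: "\<And>l. l \<in> {- int N..0} \<Longrightarrow>
      (\<Sum>p\<le>M. d p * (fdiff 1 ^^ p) (subdiv_seq a c (Suc n)) l) = 0"
    and l: "l \<in> {- int N..2 ^ i - 1}"
  shows "(\<Sum>p\<le>M. d p * (fdiff (2 ^ i) ^^ p) (subdiv_seq a c (Suc (n + i))) l) = 0"
  using l
proof (induction i arbitrary: l)
  case 0
  then show ?case using base by simp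
next
  case (Suc i)
  let ?A = "a (Suc (n + i))" and ?c = "subdiv_seq a c (Suc (n + i))"
  let ?I = "{m. l - 2 * m \<in> {0..int N}}"
  have supp': "k \<notin> {0..int N} \<Longrightarrow> ?A k = 0" for k using supp[of "Suc (n + i)" k] by simp
  have eq: "subdiv_op ?A c l = (\<Sum>m\<in>?I. complex_of_real (?A (l - 2 * m)) * c m)" for c
    by (rule subdiv_op_eq_sum(1)) (rule supp')
  have commute: "(fdiff (2 * s) ^^ p) (subdiv_op ?A c) = subdiv_op ?A ((fdiff s ^^ p) c)" for s p c
    by (rule funpow_fdiff_subdiv_op) (rule supp')
  have "(\<Sum>p\<le>M. d p * (fdiff (2 ^ Suc i) ^^ p) (subdiv_seq a c (Suc (n + Suc i))) l)
      = (\<Sum>p\<le>M. d p * (\<Sum>m\<in>?I. complex_of_real (?A (l - 2 * m)) * (fdiff (2 ^ i) ^^ p) ?c m))"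
    by (simp add: commute eq del: mem_Collect_eq atLeastAtMost_iff)
  also have "\<dots> = (\<Sum>m\<in>?I. complex_of_real (?A (l - 2 * m)) * (\<Sum>p\<le>M. d p * (fdiff (2 ^ i) ^^ p) ?c m))"
    unfolding sum_distrib_left by (subst sum.swap) (simp add: mult_ac)
  also have "\<dots> = 0"
  proof (intro sum.neutral ballI)
    fix m assume "m \<in> ?I"
    then have "m \<in> {- int N..2 ^ i - 1}" using Suc.prems by auto
    then show "complex_of_real (?A (l - 2 * m)) * (\<Sum>p\<le>M. d p * (fdiff (2 ^ i) ^^ p) ?c m) = 0"
      using Suc.IH by simp
  qed
  finally show ?case .
qed

text \<open>The index \<open>k\<close> at level \<open>n + 1\<close> and the index \<open>2\<^sup>t k\<close> at level \<open>n + 1 + t\<close> belong to the same grid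
  point, so uniform convergence on the singleton of this point suffices.\<close>

lemma is_subdiv_limit_imp_tendsto:
  assumes "is_subdiv_limit a c f"
  shows "(\<lambda>t. subdiv_seq a c (Suc (n + t)) (k * 2 ^ t)) \<longlonglongrightarrow> f (of_int k / 2 ^ n)"
proof -
  let ?x = "of_int k / 2 ^ n :: real"
  let ?E = "\<lambda>j k. ennreal (cmod (subdiv_seq a c j k - f (real_of_int k / 2 ^ (j - 1))))"
  have "(\<lambda>j. SUP k \<in> {k. real_of_int k / 2 ^ (j - 1) \<in> {?x}}. ?E j k) \<longlonglongrightarrow> 0"
    using assms compact_sing[of ?x] unfolding is_subdiv_limit_def by blast
  from LIMSEQ_ignore_initial_segment[OF this, of "Suc n"]
  have lim: "(\<lambda>t. SUP k \<in> {k. real_of_int k / 2 ^ (n + t) \<in> {?x}}. ?E (Suc (n + t)) k) \<longlonglongrightarrow> 0"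
    by (simp add: add.commute)
  have "(\<lambda>t. ennreal (cmod (subdiv_seq a c (Suc (n + t)) (k * 2 ^ t) - f ?x))) \<longlonglongrightarrow> 0"
  proof (rule tendsto_sandwich[OF _ _ tendsto_const lim])
    show "eventually (\<lambda>t. ennreal (cmod (subdiv_seq a c (Suc (n + t)) (k * 2 ^ t) - f ?x))
        \<le> (SUP k \<in> {k. real_of_int k / 2 ^ (n + t) \<in> {?x}}. ?E (Suc (n + t)) k)) sequentially"
    proof (intro always_eventually allI)
      fix t
      show "ennreal (cmod (subdiv_seq a c (Suc (n + t)) (k * 2 ^ t) - f ?x))
          \<le> (SUP k \<in> {k. real_of_int k / 2 ^ (n + t) \<in> {?x}}. ?E (Suc (n + t)) k)"
        by (rule SUP_upper2[where i = "k * 2 ^ t"]) (simp_all add: power_add)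
    qed
  qed simp
  then have "(\<lambda>t. cmod (subdiv_seq a c (Suc (n + t)) (k * 2 ^ t) - f ?x)) \<longlonglongrightarrow> 0"
    by (simp add: ennreal_tendsto_0_iff)
  then show ?thesis by (rule LIM_zero_cancel[OF tendsto_norm_zero_cancel])
qed

lemma is_subdiv_limit_fdiff_tendsto:
  assumes "is_subdiv_limit a c f"
  shows "(\<lambda>t. (fdiff (s * 2 ^ t) ^^ p) (subdiv_seq a c (Suc (n + t))) (k * 2 ^ t))
    \<longlonglongrightarrow> (fdiff (of_int s / 2 ^ n) ^^ p) f (of_int k / 2 ^ n)"
proof (induction p arbitrary: k)
  case 0
  then show ?case using is_subdiv_limit_imp_tendsto[OF assms] by simp
next
  case (Suc p)
  from tendsto_diff[OF Suc[of "k + s"] Suc[of k]]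
  show ?case by (simp add: fdiff_def distrib_right add_divide_distrib)
qed

lemma vanishing_on_dyadics:
  fixes G :: "real \<Rightarrow> complex"
  assumes cont: "continuous_on UNIV G"
    and zero: "\<And>i k. k \<in> {0..2 ^ i - 1} \<Longrightarrow> G (of_int k / 2 ^ (n + i)) = 0"
    and x: "0 < x" "x < 1 / 2 ^ n"
  shows "G x = 0"
proof -
  define y where "y i = of_int \<lfloor>x * 2 ^ (n + i)\<rfloor> / (2 :: real) ^ (n + i)" for i
  have "\<lfloor>x * 2 ^ (n + i)\<rfloor> \<in> {0..2 ^ i - 1}" for i
  proof -
    have "x * 2 ^ (n + i) < of_int (2 ^ i)" using x(2) by (simp add: power_add field_simps)
    then have "\<lfloor>x * 2 ^ (n + i)\<rfloor> < 2 ^ i" by (simp add: floor_less_iff)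
    then show ?thesis using x(1) by simp
  qed
  then have Gy: "G (y i) = 0" for i unfolding y_def by (rule zero)
  have "y \<longlonglongrightarrow> x"
  proof (rule LIM_zero_cancel, rule tendsto_0_le[where K = 1])
    show "(\<lambda>i. (1 / 2) ^ i :: real) \<longlonglongrightarrow> 0" by (rule LIMSEQ_power_zero) simp
    show "eventually (\<lambda>i. norm (y i - x) \<le> norm ((1 / 2) ^ i :: real) * 1) sequentially"
    proof (intro always_eventually allI)
      fix i
      have "y i - x = (of_int \<lfloor>x * 2 ^ (n + i)\<rfloor> - x * 2 ^ (n + i)) / 2 ^ (n + i)"
        by (simp add: y_def diff_divide_distrib)
      then have "\<bar>y i - x\<bar> = \<bar>of_int \<lfloor>x * 2 ^ (n + i)\<rfloor> - x * 2 ^ (n + i)\<bar> / 2 ^ (n + i)"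
        by simp
      also have "\<dots> \<le> 1 / 2 ^ (n + i)" by (intro divide_right_mono) (linarith, simp)
      also have "\<dots> \<le> 1 / 2 ^ i" by (intro divide_left_mono power_increasing) auto
      finally show "norm (y i - x) \<le> norm ((1 / 2) ^ i :: real) * 1" by (simp add: power_one_over)
    qed
  qed
  moreover have "isCont G x" using cont by (simp add: continuous_on_eq_continuous_at)
  ultimately have "(\<lambda>i. G (y i)) \<longlonglongrightarrow> G x" by (rule isCont_tendsto_compose[rotated])
  then show ?thesis by (simp add: Gy LIMSEQ_const_iff)
qed

text \<open>\<open>N + 2\<close> difference orders against \<open>N + 1\<close> window positions give the coefficients \<open>d\<close>. The relation
  passes to the dyadic points of \<open>[0, 2\<^sup>-\<^sup>n)\<close>, by continuity to \<open>(0, 2\<^sup>-\<^sup>n)\<close>, by analyticity to \<open>\<real>\<close>.\<close>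

lemma analytic_limit_difference_relation:
  assumes supp: "\<And>j k. j \<ge> 1 \<Longrightarrow> k \<notin> {0..int N} \<Longrightarrow> a j k = 0"
    and f: "is_subdiv_limit a c f" and series: "locally_power_series f"
  shows "\<exists>d. (\<exists>p\<le>Suc N. d p \<noteq> 0) \<and> (\<forall>x. (\<Sum>p\<le>Suc N. d p * (fdiff (1 / 2 ^ n) ^^ p) f x) = 0)"
proof -
  have card: "card {- int N..0} < card {..Suc N}" by simp
  obtain d where d: "\<exists>p\<in>{..Suc N}. d p \<noteq> 0"
    "\<forall>l\<in>{- int N..0}. (\<Sum>p\<le>Suc N. d p * (fdiff 1 ^^ p) (subdiv_seq a c (Suc n)) l) = 0"
    using linear_dependence[OF finite_atLeastAtMost_int finite_atMost card,
        of "\<lambda>p. (fdiff 1 ^^ p) (subdiv_seq a c (Suc n))"]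
    by blast
  define G where "G x = (\<Sum>p\<le>Suc N. d p * (fdiff (1 / 2 ^ n) ^^ p) f x)" for x
  have cont_f: "continuous_on UNIV f" using f by (simp add: is_subdiv_limit_def)
  have "continuous_on UNIV ((fdiff s ^^ p) f)" for s p
  proof (induction p)
    case (Suc p)
    have "continuous_on UNIV (\<lambda>x. (fdiff s ^^ p) f (x + s))"
      by (rule continuous_on_compose2[OF Suc]) (auto intro!: continuous_intros)
    then show ?case using Suc by (auto simp: fdiff_def[abs_def] intro!: continuous_intros)
  qed (use cont_f in simp)
  then have cont: "continuous_on UNIV G" unfolding G_def[abs_def] by (intro continuous_intros)
  have dyadic: "G (of_int k / 2 ^ (n + i)) = 0" if k: "k \<in> {0..2 ^ i - 1}" for i k
  proof -
    \<comment> \<open>The step \<open>2 ^ i\<close> on the grid of level \<open>n + i + 1\<close> is the real step \<open>1 / 2 ^ n\<close>.\<close>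
    have "(\<lambda>t. \<Sum>p\<le>Suc N. d p * (fdiff (2 ^ i * 2 ^ t) ^^ p)
          (subdiv_seq a c (Suc (n + i + t))) (k * 2 ^ t))
        \<longlonglongrightarrow> (\<Sum>p\<le>Suc N. d p * (fdiff (of_int (2 ^ i) / 2 ^ (n + i)) ^^ p) f (of_int k / 2 ^ (n + i)))"
      by (intro tendsto_intros is_subdiv_limit_fdiff_tendsto f)
    moreover have "(\<Sum>p\<le>Suc N. d p * (fdiff (2 ^ i * 2 ^ t) ^^ p)
        (subdiv_seq a c (Suc (n + i + t))) (k * 2 ^ t)) = 0" for t
    proof -
      have "k * 2 ^ t \<le> (2 ^ i - 1) * 2 ^ t" using k by (intro mult_right_mono) auto
      also have "\<dots> \<le> 2 ^ (i + t) - 1" by (simp add: power_add left_diff_distrib)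
      finally have "k * 2 ^ t \<in> {- int N..2 ^ (i + t) - 1}" 
        using k by (auto intro: order_trans[of _ 0])
      then have "(\<Sum>p\<le>Suc N. d p * (fdiff (2 ^ (i + t)) ^^ p)
          (subdiv_seq a c (Suc (n + (i + t)))) (k * 2 ^ t)) = 0"
        using d(2) by (intro difference_relation_propagates[where a = a, OF supp]) blast+
      then show ?thesis by (simp add: power_add add.assoc del: sum.atMost_Suc)
    qed
    ultimately have "(\<Sum>p\<le>Suc N. d p * (fdiff (of_int (2 ^ i) / 2 ^ (n + i)) ^^ p) f (of_int k / 2 ^ (n + i))) = 0"
      by (simp add: LIMSEQ_const_iff del: sum.atMost_Suc)
    then show ?thesis by (simp add: G_def power_add del: sum.atMost_Suc)
  qed
  have "G x = 0" for x
  proof (rule locally_power_series_eq_0[OF cont])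
    show "locally_power_series G"
      unfolding G_def[abs_def]
      by (intro locally_power_series_sum locally_power_series_fdiff series) simp
    show "0 < (1 / 2 ^ n :: real)" by simp
    show "G x = 0" if "0 < x" "x < 1 / 2 ^ n" for x
      using vanishing_on_dyadics[OF cont dyadic that] .
  qed
  then show ?thesis using d(1) by (auto simp: G_def del: sum.atMost_Suc)
qed

section \<open>Analytic limits\<close>

theorem theorem5p2:
  fixes N :: nat
    and a :: "nat \<Rightarrow> int \<Rightarrow> real"
    and C :: real
    and \<phi> :: "real \<Rightarrow> complex"
  assumes supp: "\<And>j k. j \<ge> 1 \<Longrightarrow> k \<notin> {0..int N} \<Longrightarrow> a j k = 0"
    and normalized: "\<And>j. j \<ge> 1 \<Longrightarrow> norm_symbol N (a j) 0 = 1"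
    and bounded: "\<And>j y. j \<ge> 1 \<Longrightarrow> cmod (norm_symbol N (a j) y) \<le> C"
    and conv: "subdiv_converges a"
    and basic: "is_subdiv_limit a delta_seq \<phi>"
    and indep: "lin_indep_shifts \<phi>"
  shows "\<forall>c f. is_subdiv_limit a c f \<and> real_analytic f \<longrightarrow> exponential_polynomial f"
proof (intro allI impI, elim conjE)
  fix c f assume f: "is_subdiv_limit a c f" and analytic: "real_analytic f"
  have series: "locally_power_series f"
    using analytic by (simp add: real_analytic_def locally_power_series_def)
  obtain D where D: "D 0 = f" and chain: "\<And>n x. (D n has_vector_derivative D (Suc n) x) (at x)"
    using analytic unfolding real_analytic_def infinitely_differentiable_def by blast
  have "(\<lambda>n. (1 / 2) ^ n :: real) \<longlonglongrightarrow> 0" by (rule LIMSEQ_power_zero) simp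
  then have "(\<lambda>n. 1 / 2 ^ n :: real) \<longlonglongrightarrow> 0" by (simp add: power_one_over)
  then obtain e where e: "\<exists>k\<le>Suc N. e k \<noteq> 0" "\<And>x. (\<Sum>k\<le>Suc N. e k * D k x) = 0"
    using difference_relations_imp_ODE[of D "\<lambda>n. 1 / 2 ^ n" "Suc N"] chain
      analytic_limit_difference_relation[OF supp f series] D
    by auto
  define P where "P = (\<Sum>k\<le>Suc N. monom (e k) k)"
  have coeff_P: "coeff P k = (if k \<le> Suc N then e k else 0)" for k
    by (simp add: P_def coeff_sum del: sum.atMost_Suc)
  have deg: "degree P \<le> Suc N" by (rule degree_le) (simp add: coeff_P)
  have "P \<noteq> 0" using e(1) coeff_P by (metis coeff_0)
  moreover have "(\<Sum>k\<le>degree P. coeff P k * D k x) = 0" for x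
  proof -
    have "(\<Sum>k\<le>degree P. coeff P k * D k x) = (\<Sum>k\<le>Suc N. coeff P k * D k x)"
      using deg by (intro sum.mono_neutral_left) (auto simp: coeff_eq_0)
    also have "\<dots> = (\<Sum>k\<le>Suc N. e k * D k x)" by (intro sum.cong) (auto simp: coeff_P)
    finally show ?thesis using e(2) by simp
  qed
  ultimately show "exponential_polynomial f"
    using constant_coefficient_ODE_exponential_polynomial[where D = D, OF chain] D by metis
qed

end
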